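(* Let $e,p \in \mathbb{Z}^+$ and suppose $U_{e,!}$ is absolute and $(e,p)$-nice. Then there exist arbitrarily long sequences of consecutive integers which iterate to $p$ after repeated application of $S_{e,!}$.
   Context: Every positive integer $n$ has a unique factoradic (factorial base) representation $n=\sum_{i=1}^k a_i\cdot i!$ with $a_k\neq 0$ and $0\leq a_i\leq i$ for $1\leq i\leq k$. For an integer $e\geq 1$, the $e$-power factoradic happy function $S_{e,!}:\mathbb{Z}_{\geq 0}\to\mathbb{Z}_{\geq 0}$ is defined by $S_{e,!}(0)=0$ and $S_{e,!}(n)=\sum_{i=1}^k a_i^e$ for $n\geq 1$; $S_{e,!}^\ell$ denotes the $\ell$-th iterate, with $S_{e,!}^0(n)=n$. $U_{e,!}$ is the set of all positive integers $n$ for which there exists $\ell\geq 1$ with $S_{e,!}^\ell(n)=n$ (fixed points and cycle elements). $U_{e,!}$ is called absolute if for every $n\in\mathbb{Z}^+$ there exists a nonnegative integer $r_n$ such that $S_{e,!}^r(n)\in U_{e,!}$ for all integers $r\geq r_n$. For $e,p\in\mathbb{Z}^+$, a set $D$ is called $(e,p)$-nice if there exists an integer $l\geq 0$ such that for every $d\in D$ there is an integer $q_d\geq 0$ with $S_{e,!}^{q_d}(l+d)=p$. *)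

theory Defs
  imports Complex_Main
begin

text \<open>Only the values \<open>a 1, \<dots>, a k\<close> of the digit function are relevant.\<close>

definition factoradic_rep :: "nat \<Rightarrow> nat \<Rightarrow> (nat \<Rightarrow> nat) \<Rightarrow> bool" where
  "factoradic_rep n k a \<longleftrightarrow>
     1 \<le> k \<and> a k \<noteq> 0 \<and> (\<forall>i\<in>{1..k}. a i \<le> i) \<and> n = (\<Sum>i=1..k. a i * fact i)"

lemma factoradic_sum_less:
  fixes a :: "nat \<Rightarrow> nat"
  assumes "\<forall>i\<in>{1..k}. a i \<le> i"
  shows "(\<Sum>i=1..k. a i * fact i) < fact (Suc k)"
  using assms
proof (induction k)
  case 0
  then show ?case by simp
next
  case (Suc k)
  have "(\<Sum>i=1..k. a i * fact i) < fact (Suc k)" using Suc by simp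
  moreover have "a (Suc k) * fact (Suc k) \<le> Suc k * fact (Suc k)"
    using Suc.prems by (intro mult_right_mono) auto
  moreover have "(fact (Suc (Suc k)) :: nat) = fact (Suc k) + Suc k * fact (Suc k)"
    by (simp add: algebra_simps)
  moreover have "(\<Sum>i=1..Suc k. a i * fact i) = (\<Sum>i=1..k. a i * fact i) + a (Suc k) * fact (Suc k)"
    by (simp del: fact_Suc)
  ultimately show ?case by linarith
qed

lemma factoradic_digits_exist:
  "n < fact (Suc k) \<Longrightarrow>
     \<exists>a::nat \<Rightarrow> nat. (\<forall>i\<in>{1..k}. a i \<le> i) \<and> n = (\<Sum>i=1..k. a i * fact i)"
proof (induction k arbitrary: n)
  case 0
  then show ?case by auto
next
  case (Suc k)
  have "n mod fact (Suc k) < fact (Suc k)" by simp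
  then obtain a :: "nat \<Rightarrow> nat" where
    a: "\<forall>i\<in>{1..k}. a i \<le> i" "n mod fact (Suc k) = (\<Sum>i=1..k. a i * fact i)"
    using Suc.IH by blast
  define b where "b = a(Suc k := n div fact (Suc k))"
  have "n < Suc (Suc k) * fact (Suc k)"
    using Suc.prems by (simp only: fact_Suc of_nat_id)
  then have "n div fact (Suc k) < Suc (Suc k)"
    by (simp only: less_mult_imp_div_less)
  then have "\<forall>i\<in>{1..Suc k}. b i \<le> i"
    using a(1) by (auto simp: b_def le_Suc_eq)
  moreover have "(\<Sum>i=1..k. b i * fact i) = (\<Sum>i=1..k. a i * fact i)"
    by (intro sum.cong) (auto simp: b_def)
  then have "(\<Sum>i=1..Suc k. b i * fact i) = n mod fact (Suc k) + n div fact (Suc k) * fact (Suc k)"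
    using a(2) by (simp add: b_def)
  then have "n = (\<Sum>i=1..Suc k. b i * fact i)" by (simp only: mod_div_mult_eq)
  ultimately show ?case by blast
qed

lemma factoradic_digits_unique:
  fixes a b :: "nat \<Rightarrow> nat"
  assumes "\<forall>i\<in>{1..k}. a i \<le> i" "\<forall>i\<in>{1..k}. b i \<le> i"
    and "(\<Sum>i=1..k. a i * fact i) = (\<Sum>i=1..k. b i * fact i)"
  shows "\<forall>i\<in>{1..k}. a i = b i"
  using assms
proof (induction k)
  case 0
  then show ?case by simp
next
  case (Suc k)
  let ?A = "\<Sum>i=1..k. a i * fact i" and ?B = "\<Sum>i=1..k. b i * fact i"
  have lt: "?A < fact (Suc k)" "?B < fact (Suc k)"
    using Suc.prems(1,2) factoradic_sum_less[of k a] factoradic_sum_less[of k b]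
    by (meson atLeastAtMost_iff le_SucI)+
  have eq: "?A + a (Suc k) * fact (Suc k) = ?B + b (Suc k) * fact (Suc k)"
    using Suc.prems(3) by (simp del: fact_Suc)
  have "(?A + a (Suc k) * fact (Suc k)) div fact (Suc k) = a (Suc k)"
    "(?B + b (Suc k) * fact (Suc k)) div fact (Suc k) = b (Suc k)"
    using lt by (simp_all del: fact_Suc)
  then have top: "a (Suc k) = b (Suc k)" using eq by metis
  then have "?A = ?B" using eq by (simp only: add_right_cancel)
  moreover have "\<forall>i\<in>{1..k}. a i \<le> i" "\<forall>i\<in>{1..k}. b i \<le> i"
    using Suc.prems(1,2) by simp_all
  ultimately have "\<forall>i\<in>{1..k}. a i = b i" using Suc.IH by blast
  then show ?case using top by (auto simp: le_Suc_eq)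
qed

lemma factoradic_rep_exists:
  assumes "0 < n"
  shows "\<exists>k a. factoradic_rep n k a"
proof -
  have "n < fact (Suc n)" using fact_ge_self[of "Suc n"] by linarith
  then obtain k where k: "n < fact (Suc k)" "\<And>j. j < k \<Longrightarrow> \<not> n < fact (Suc j)"
    using exists_least_iff[of "\<lambda>k. n < fact (Suc k)"] by blast
  have k1: "1 \<le> k" using assms k(1) by (cases k) auto
  obtain a :: "nat \<Rightarrow> nat" where
    a: "\<forall>i\<in>{1..k}. a i \<le> i" "n = (\<Sum>i=1..k. a i * fact i)"
    using factoradic_digits_exist[OF k(1)] by blast
  obtain j where j: "k = Suc j" using k1 by (cases k) auto
  have "a k \<noteq> 0"
  proof
    assume "a k = 0"
    then have "n = (\<Sum>i=1..j. a i * fact i)" using a(2) j by simp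
    also have "\<dots> < fact (Suc j)" using a(1) j by (intro factoradic_sum_less) auto
    finally show False using k(2)[of j] j by simp
  qed
  then show ?thesis using a k1 unfolding factoradic_rep_def by blast
qed

lemma factoradic_rep_bounds:
  assumes "factoradic_rep n k a"
  shows "fact k \<le> n" "n < fact (Suc k)"
proof -
  have "fact k \<le> a k * fact k" using assms by (simp add: factoradic_rep_def)
  also have "\<dots> \<le> (\<Sum>i=1..k. a i * fact i)"
    using assms by (intro member_le_sum) (auto simp: factoradic_rep_def)
  finally show "fact k \<le> n" using assms by (simp add: factoradic_rep_def)
  show "n < fact (Suc k)"
    using assms factoradic_sum_less unfolding factoradic_rep_def by blast
qed

lemma factoradic_rep_unique:
  assumes "factoradic_rep n k a" "factoradic_rep n m b"
  shows "k = m" "\<forall>i\<in>{1..k}. a i = b i"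
proof -
  have "\<not> k < m" if "factoradic_rep n k a" "factoradic_rep n m b" for k m a b
  proof
    assume "k < m"
    then have "(fact (Suc k) :: nat) \<le> fact m" by (intro fact_mono) simp
    then show False
      using factoradic_rep_bounds(2)[OF that(1)] factoradic_rep_bounds(1)[OF that(2)] by linarith
  qed
  then show eq: "k = m" using assms by (meson linorder_neqE_nat)
  show "\<forall>i\<in>{1..k}. a i = b i"
    using assms eq by (intro factoradic_digits_unique) (auto simp: factoradic_rep_def)
qed

definition fact_happy :: "nat \<Rightarrow> nat \<Rightarrow> nat" where
  "fact_happy e n =
     (if n = 0 then 0 else THE s. \<exists>k a. factoradic_rep n k a \<and> s = (\<Sum>i=1..k. a i ^ e))"

lemma fact_happy_0 [simp]: "fact_happy e 0 = 0"
  by (simp add: fact_happy_def)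

lemma fact_happy_eq:
  assumes "factoradic_rep n k a"
  shows "fact_happy e n = (\<Sum>i=1..k. a i ^ e)"
proof -
  have "n \<noteq> 0" using factoradic_rep_bounds(1)[OF assms] fact_gt_zero[of k] by (metis not_le)
  moreover have "(THE s. \<exists>k a. factoradic_rep n k a \<and> s = (\<Sum>i=1..k. a i ^ e))
      = (\<Sum>i=1..k. a i ^ e)"
  proof (rule the_equality)
    fix s assume "\<exists>k a. factoradic_rep n k a \<and> s = (\<Sum>i=1..k. a i ^ e)"
    then obtain m b where b: "factoradic_rep n m b" "s = (\<Sum>i=1..m. b i ^ e)" by blast
    show "s = (\<Sum>i=1..k. a i ^ e)"
      using factoradic_rep_unique[OF assms b(1)] b(2) by simp
  qed (use assms in blast)
  ultimately show ?thesis by (simp add: fact_happy_def)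
qed

definition fact_happy_cycles :: "nat \<Rightarrow> nat set" where
  "fact_happy_cycles e = {n. 1 \<le> n \<and> (\<exists>l\<ge>1. (fact_happy e ^^ l) n = n)}"

definition fact_happy_absolute :: "nat \<Rightarrow> bool" where
  "fact_happy_absolute e \<longleftrightarrow>
     (\<forall>n\<ge>1. \<exists>r\<^sub>n. \<forall>r\<ge>r\<^sub>n. (fact_happy e ^^ r) n \<in> fact_happy_cycles e)"

definition fact_happy_nice :: "nat \<Rightarrow> nat \<Rightarrow> nat set \<Rightarrow> bool" where
  "fact_happy_nice e p D \<longleftrightarrow> (\<exists>l. \<forall>d\<in>D. \<exists>q. (fact_happy e ^^ q) (l + d) = p)"

end

theory Submission
  imports Defs
begin

text \<open>
  For every bound \<open>N\<close> and every \<open>t\<close> there is a shift \<open>m\<close> with \<open>S (m + n) = t + S n\<close> for all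
  \<open>n \<le> N\<close>: let \<open>m\<close> be a sum of \<open>t\<close> distinct large factorials, so that adding \<open>m\<close> only inserts
  digits 1 in front of those of \<open>n\<close>. Iterating this, for every \<open>r\<close> and \<open>l\<close> some \<open>m\<close> satisfies
  \<open>S\<^sup>r (m + n) = l + S\<^sup>r n\<close> for all \<open>n \<le> N\<close>. If \<open>r\<close> is so large that \<open>S\<^sup>r n\<close> is a cycle element for
  \<open>1 \<le> n \<le> N\<close>, and \<open>l\<close> witnesses niceness, then \<open>m + 1, \<dots>, m + N\<close> all reach \<open>p\<close>.
\<close>

text \<open>Leading zero digits are allowed here; \<open>e \<ge> 1\<close> makes them contribute \<open>0\<close> rather than \<open>0 ^ 0 = 1\<close>.\<close>

lemma fact_happy_padded:
  fixes a :: "nat \<Rightarrow> nat"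
  assumes "1 \<le> e" "\<forall>i\<in>{1..k}. a i \<le> i"
  shows "fact_happy e (\<Sum>i=1..k. a i * fact i) = (\<Sum>i=1..k. a i ^ e)"
  using assms(2)
proof (induction k)
  case 0
  then show ?case by simp
next
  case (Suc k)
  show ?case
  proof (cases "a (Suc k) = 0")
    case True
    then show ?thesis using Suc assms(1) by (simp add: power_0_left)
  next
    case False
    then have "factoradic_rep (\<Sum>i=1..Suc k. a i * fact i) (Suc k) a"
      using Suc.prems by (simp add: factoradic_rep_def)
    then show ?thesis by (rule fact_happy_eq)
  qed
qed

lemma fact_happy_add_fact:
  assumes "1 \<le> e" "n < fact (Suc k)"
  shows "fact_happy e (n + fact (Suc k)) = Suc (fact_happy e n)"
proof -
  obtain a :: "nat \<Rightarrow> nat" where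
    a: "\<forall>i\<in>{1..k}. a i \<le> i" "n = (\<Sum>i=1..k. a i * fact i)"
    using factoradic_digits_exist[OF assms(2)] by blast
  define b where "b = a(Suc k := 1)"
  have b: "\<forall>i\<in>{1..Suc k}. b i \<le> i"
    using a(1) by (auto simp: b_def le_Suc_eq)
  have "(\<Sum>i=1..k. b i * fact i) = n"
    unfolding a(2) by (intro sum.cong) (auto simp: b_def)
  then have "(\<Sum>i=1..Suc k. b i * fact i) = n + fact (Suc k)"
    by (simp add: b_def del: fact_Suc)
  moreover have "(\<Sum>i=1..k. b i ^ e) = (\<Sum>i=1..k. a i ^ e)"
    by (intro sum.cong) (auto simp: b_def)
  then have "(\<Sum>i=1..Suc k. b i ^ e) = Suc (fact_happy e n)"
    using fact_happy_padded[OF assms(1) a(1)] a(2) by (simp add: b_def)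
  ultimately show ?thesis
    using fact_happy_padded[OF assms(1) b] by simp
qed

lemma fact_happy_shift:
  assumes "1 \<le> e"
  shows "\<exists>m. \<forall>n\<le>N. fact_happy e (m + n) = t + fact_happy e n"
proof (induction t)
  case 0
  show ?case by (intro exI[of _ 0]) simp
next
  case (Suc t)
  then obtain m where m: "\<forall>n\<le>N. fact_happy e (m + n) = t + fact_happy e n" by blast
  \<comment> \<open>As \<open>m + n \<le> ?k < fact (Suc ?k)\<close>, the new factorial puts a digit
    1 above all digits of \<open>m + n\<close>, for every \<open>n \<le> N\<close> at once.\<close>
  let ?k = "m + N"
  have "fact_happy e (m + fact (Suc ?k) + n) = Suc t + fact_happy e n" if "n \<le> N" for n
  proof -
    have "m + n < fact (Suc ?k)"
      using that fact_ge_self[of "Suc ?k"] by linarith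
    from fact_happy_add_fact[OF assms this] show ?thesis
      using m that by (simp add: ac_simps del: fact_Suc)
  qed
  then show ?case by blast
qed

lemma fact_happy_funpow_shift:
  assumes "1 \<le> e"
  shows "\<exists>m. \<forall>n\<le>N. (fact_happy e ^^ r) (m + n) = l + (fact_happy e ^^ r) n"
proof (induction r arbitrary: N)
  case 0
  show ?case by auto
next
  case (Suc r)
  \<comment> \<open>One step turns the offset \<open>n\<close> into \<open>fact_happy e n\<close>,
    so the induction hypothesis is needed up to \<open>M\<close> instead of
    \<open>N\<close>.\<close>
  define M where "M = Max (fact_happy e ` {..N})"
  have M: "fact_happy e n \<le> M" if "n \<le> N" for n
    using that by (simp add: M_def)
  obtain t where t: "\<forall>n\<le>M. (fact_happy e ^^ r) (t + n) = l + (fact_happy e ^^ r) n"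
    using Suc.IH by blast
  obtain m where "\<forall>n\<le>N. fact_happy e (m + n) = t + fact_happy e n"
    using fact_happy_shift[OF assms] by blast
  then show ?case
    using M t by (intro exI[of _ m]) (simp add: funpow_Suc_right del: funpow.simps)
qed

theorem theorem1p3:
  fixes e p :: nat
  assumes "e \<ge> 1" and "p \<ge> 1"
    and "fact_happy_absolute e"
    and "fact_happy_nice e p (fact_happy_cycles e)"
  shows "\<forall>N. \<exists>m\<ge>1. \<forall>n\<in>{m..<m + N}. \<exists>q. (fact_happy e ^^ q) n = p"
proof
  fix N
  obtain R where R: "\<And>n r. 1 \<le> n \<Longrightarrow> R n \<le> r \<Longrightarrow> (fact_happy e ^^ r) n \<in> fact_happy_cycles e"
    using assms(3) unfolding fact_happy_absolute_def by metis
  define r where "r = Max (R ` {..N})"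
  have cycle: "(fact_happy e ^^ r) n \<in> fact_happy_cycles e" if "1 \<le> n" "n \<le> N" for n
    using that by (intro R) (auto simp: r_def)
  obtain l where l: "\<forall>d\<in>fact_happy_cycles e. \<exists>q. (fact_happy e ^^ q) (l + d) = p"
    using assms(4) unfolding fact_happy_nice_def by blast
  obtain m where m: "\<forall>n\<le>N. (fact_happy e ^^ r) (m + n) = l + (fact_happy e ^^ r) n"
    using fact_happy_funpow_shift[OF assms(1)] by blast
  \<comment> \<open>The block starts at \<open>Suc m\<close> because the offset 0 stays at 0, which
    is not a cycle element.\<close>
  have "\<exists>q. (fact_happy e ^^ q) n = p" if "n \<in> {Suc m..<Suc m + N}" for n
  proof -
    have n: "1 \<le> n - m" "n - m \<le> N" "m + (n - m) = n" using that by auto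
    then obtain q where "(fact_happy e ^^ q) (l + (fact_happy e ^^ r) (n - m)) = p"
      using cycle l by blast
    then have "(fact_happy e ^^ (q + r)) n = p"
      using m n by (metis comp_apply funpow_add)
    then show ?thesis by blast
  qed
  then show "\<exists>m\<ge>1. \<forall>n\<in>{m..<m + N}. \<exists>q. (fact_happy e ^^ q) n = p"
    by (intro exI[of _ "Suc m"]) simp
qed

end
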